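(* Let $k,n_2,n_3\in\mathbb{N}$ with $n_2\ge 2$ and $n_3\ge 2$. If $k\ge 2$, then $P_2\square P_{n_2}\square P_{n_3}$ is equitably $k$-list arborable.
   Context: $P_n$ denotes the path on $n$ vertices and $\square$ the Cartesian product. A $k$-uniform list assignment $L$ for $G$ assigns to each vertex $v$ a set $L(v)$ of exactly $k$ colours; an $L$-colouring is a map $c$ with $c(v)\in L(v)$; it is equitable if every colour class has at most $\lceil |V(G)|/k\rceil$ vertices. $G$ is equitably $k$-list arborable if for every $k$-uniform list assignment $L$ there is an equitable $L$-colouring of $G$ in which every colour class induces an acyclic subgraph. *)

theory Defs
  imports Complex_Main "Graph_Theory.Graph_Theory"
begin

text \<open>
  Simple graphs are loop-free symmetric digraphs without parallel arcs, as in the locale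
  \<open>pair_graph\<close>: an edge \<open>{u, v}\<close> is the pair of arcs \<open>(u, v)\<close>, \<open>(v, u)\<close>.
\<close>

definition path_graph :: "nat \<Rightarrow> nat pair_pre_digraph" where
  "path_graph n =
     \<lparr> pverts = {0..<n},
       parcs = {(i, j). i < n \<and> j < n \<and> (j = Suc i \<or> i = Suc j)} \<rparr>"

definition cart_prod ::
  "'a pair_pre_digraph \<Rightarrow> 'b pair_pre_digraph \<Rightarrow> ('a \<times> 'b) pair_pre_digraph"
  (infixl \<open>\<square>\<close> 70) where
  "G \<square> H =
     \<lparr> pverts = pverts G \<times> pverts H,
       parcs = {((u, v), (u', v')).
         (u = u' \<and> u \<in> pverts G \<and> (v, v') \<in> parcs H) \<or>
         ((u, u') \<in> parcs G \<and> v = v' \<and> v \<in> pverts H)} \<rparr>"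

lemma pair_graph_path_graph: "pair_graph (path_graph n)"
proof
  show "finite (parcs (path_graph n))"
    by (rule finite_subset[of _ "{0..<n} \<times> {0..<n}"]) (auto simp: path_graph_def)
qed (auto simp: path_graph_def symmetric_def sym_def)

lemma pair_graph_cart_prod:
  assumes "pair_graph G" "pair_graph H"
  shows "pair_graph (G \<square> H)"
proof -
  interpret G: pair_graph G by fact
  interpret H: pair_graph H by fact
  have symG: "(v, u) \<in> parcs G" if "(u, v) \<in> parcs G" for u v
    using G.pair_sym_arcs that by (auto simp: symmetric_def sym_def)
  have symH: "(v, u) \<in> parcs H" if "(u, v) \<in> parcs H" for u v
    using H.pair_sym_arcs that by (auto simp: symmetric_def sym_def)
  have sub: "parcs (G \<square> H) \<subseteq> (pverts G \<times> pverts H) \<times> (pverts G \<times> pverts H)"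
    by (auto simp: cart_prod_def dest: G.wellformed' H.wellformed')
  show ?thesis
  proof
    show "finite (parcs (G \<square> H))"
      by (rule finite_subset[OF sub])
        (intro finite_cartesian_product G.pair_finite_verts H.pair_finite_verts)
    show "finite (pverts (G \<square> H))"
      by (simp add: cart_prod_def G.pair_finite_verts H.pair_finite_verts)
    show "fst e \<in> pverts (G \<square> H)" "snd e \<in> pverts (G \<square> H)" if "e \<in> parcs (G \<square> H)" for e
      using that by (auto simp: cart_prod_def dest: G.wellformed' H.wellformed')
    show "fst e \<noteq> snd e" if "e \<in> parcs (G \<square> H)" for e
      using that by (auto simp: cart_prod_def dest: G.pair_no_loops H.pair_no_loops)
    show "symmetric (with_proj (G \<square> H))"
      by (auto simp: symmetric_def sym_def cart_prod_def intro: symG symH)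
  qed
qed

text \<open>
  The digraph notion \<^const>\<open>pre_digraph.cycle\<close> also counts the closed walk \<open>u, v, u\<close> along
  a single edge, so \<^const>\<open>forest\<close> is too strong for undirected graphs; a cycle of a simple
  graph has length at least 3.
\<close>

definition acyclic_graph :: "('a, 'b) pre_digraph \<Rightarrow> bool" where
  "acyclic_graph G \<longleftrightarrow> \<not> (\<exists>p. pre_digraph.cycle G p \<and> 3 \<le> length p)"

definition uniform_list_assignment ::
  "'a pair_pre_digraph \<Rightarrow> nat \<Rightarrow> ('a \<Rightarrow> 'c set) \<Rightarrow> bool" where
  "uniform_list_assignment G k L \<longleftrightarrow> (\<forall>v\<in>pverts G. finite (L v) \<and> card (L v) = k)"

definition list_colouring ::
  "'a pair_pre_digraph \<Rightarrow> ('a \<Rightarrow> 'c set) \<Rightarrow> ('a \<Rightarrow> 'c) \<Rightarrow> bool" where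
  "list_colouring G L c \<longleftrightarrow> (\<forall>v\<in>pverts G. c v \<in> L v)"

definition colour_class :: "'a pair_pre_digraph \<Rightarrow> ('a \<Rightarrow> 'c) \<Rightarrow> 'c \<Rightarrow> 'a set" where
  "colour_class G c x = {v \<in> pverts G. c v = x}"

definition equitable_colouring :: "'a pair_pre_digraph \<Rightarrow> nat \<Rightarrow> ('a \<Rightarrow> 'c) \<Rightarrow> bool" where
  "equitable_colouring G k c \<longleftrightarrow>
     (\<forall>x. int (card (colour_class G c x)) \<le> \<lceil>real (card (pverts G)) / real k\<rceil>)"

text \<open>
  The colours are drawn from the type \<open>'c\<close>, made explicit by the first argument; a statement
  about all list assignments takes \<open>'c\<close> to be a type variable.
\<close>

definition equitably_list_arborable ::
  "'c itself \<Rightarrow> nat \<Rightarrow> 'a pair_pre_digraph \<Rightarrow> bool" where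
  "equitably_list_arborable (_ :: 'c itself) k G \<longleftrightarrow>
     (\<forall>L :: 'a \<Rightarrow> 'c set. uniform_list_assignment G k L \<longrightarrow>
       (\<exists>c. list_colouring G L c \<and> equitable_colouring G k c \<and>
         (\<forall>x. acyclic_graph (with_proj G \<restriction> colour_class G c x))))"

end

theory Submission
  imports Defs
begin

text \<open>
  Colour the vertices in blocks of at most \<open>k\<close>, giving distinct colours within a block. The
  \<open>i\<close>-th vertex of a block (counting from 0) can avoid the \<open>i\<close> colours already used in the
  block and every colour occurring twice among its earlier neighbours as long as it has fewer than
  \<open>2 * (k - i)\<close> of those; each colour class then stays a forest. For \<open>k \<ge> 3\<close> consecutive
  blocks of the lexicographic order qualify.

  For \<open>k = 2\<close> the grid has no such partition into pairs, because its minimum degree is 3.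
  If the lists are not all equal, there are a corner \<open>s\<close> and a vertex \<open>w\<close> in another row
  with \<open>L w \<noteq> L s\<close>. Colour \<open>w\<close> with some \<open>x\<^sub>0 \<notin> L s\<close>, then everything except \<open>s\<close> in
  pairs, and finally \<open>s\<close>, which has only 3 neighbours. As \<open>s\<close> cannot receive \<open>x\<^sub>0\<close>, the two
  unpaired vertices have different colours and no class exceeds half of the vertices.
  If all lists are equal, colour \<open>((a, i), j)\<close> by the parity of \<open>a + i\<close>.
\<close>

section \<open>Forests as one-degenerate sets\<close>

definition nbrs :: "'a pair_pre_digraph \<Rightarrow> 'a \<Rightarrow> 'a set" where
  "nbrs G v = {u. (v, u) \<in> parcs G}"

text \<open>One-degeneracy, which for induced subgraphs of a simple graph is the same as being a forest.\<close>

definition forest_on :: "('a \<Rightarrow> 'a set) \<Rightarrow> 'a set \<Rightarrow> bool" where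
  "forest_on N A \<longleftrightarrow> (\<forall>B\<subseteq>A. B \<noteq> {} \<longrightarrow> (\<exists>x\<in>B. card (N x \<inter> B) \<le> 1))"

lemma pcas_ends:
  "pcas u p v \<Longrightarrow> p \<noteq> [] \<Longrightarrow> fst (p ! 0) = u \<and> snd (p ! (length p - 1)) = v"
proof (induction p arbitrary: u)
  case (Cons e p)
  then show ?case by (cases p) auto
qed auto

lemma pcas_consecutive:
  "pcas u p v \<Longrightarrow> Suc i < length p \<Longrightarrow> snd (p ! i) = fst (p ! Suc i)"
proof (induction p arbitrary: u i)
  case (Cons e p)
  show ?case
  proof (cases i)
    case 0
    with Cons.prems show ?thesis by (cases p) auto
  next
    case (Suc j)
    with Cons show ?thesis by auto
  qed
qed auto

text \<open>Turns the distinctness clause of \<open>cycle\<close> into distinctness of the heads of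
  its arcs.\<close>

lemma tl_pawalk_verts: "pcas u p v \<Longrightarrow> tl (pawalk_verts u p) = map snd p"
proof (induction p arbitrary: u)
  case (Cons e p)
  then show ?case by (cases p) auto
qed auto

text \<open>A vertex on a cycle of length at least 3 has two distinct neighbours there, its
  successor and its predecessor, so the vertices of a cycle inside \<open>S\<close> would violate
  \<open>forest_on\<close>.\<close>

lemma acyclic_graph_induce_subgraph:
  assumes sym: "\<And>u v. (u, v) \<in> parcs G \<Longrightarrow> (v, u) \<in> parcs G"
    and S: "forest_on (nbrs G) S"
  shows "acyclic_graph (with_proj G \<restriction> S)"
  unfolding acyclic_graph_def
proof
  let ?H = "with_proj G \<restriction> S"
  assume "\<exists>p. pre_digraph.cycle ?H p \<and> 3 \<le> length p"
  then obtain p where p: "pre_digraph.cycle ?H p" "3 \<le> length p" by blast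
  \<comment> \<open>Walks depend only on tails and heads, which restriction to an induced subgraph
    leaves unchanged.\<close>
  have cas: "pre_digraph.cas ?H = pcas"
  proof (intro ext)
    show "pre_digraph.cas ?H u q v = pcas u q v" for u q v
      by (induction q arbitrary: u) (simp_all add: pre_digraph.cas.simps induce_subgraph_def)
  qed
  have vts: "pre_digraph.awalk_verts ?H = pawalk_verts"
  proof (intro ext)
    show "pre_digraph.awalk_verts ?H u q = pawalk_verts u q" for u q
      by (induction q arbitrary: u)
        (simp_all add: pre_digraph.awalk_verts.simps induce_subgraph_def)
  qed
  from p obtain u where u: "set p \<subseteq> arcs ?H" "pcas u p u" "distinct (tl (pawalk_verts u p))"
    by (auto simp: pre_digraph.cycle_def pre_digraph.awalk_def cas vts)
  have dist: "distinct (map snd p)"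
    using u(2,3) by (simp add: tl_pawalk_verts)
  define l where "l = length p"
  define B where "B = set (map snd p)"
  have arc: "p ! i \<in> parcs G" "fst (p ! i) \<in> S" "snd (p ! i) \<in> S" if "i < l" for i
  proof -
    have "set p \<subseteq> {e \<in> parcs G. fst e \<in> S \<and> snd e \<in> S}"
      using u(1) by (simp add: induce_subgraph_def)
    moreover have "p ! i \<in> set p" using that by (simp add: l_def)
    ultimately have "p ! i \<in> {e \<in> parcs G. fst e \<in> S \<and> snd e \<in> S}" by (rule subsetD)
    then show "p ! i \<in> parcs G" "fst (p ! i) \<in> S" "snd (p ! i) \<in> S" by auto
  qed
  have "B \<subseteq> S"
    using u(1) by (auto simp: B_def induce_subgraph_def)
  moreover have "B \<noteq> {}" using p(2) by (auto simp: B_def)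
  ultimately obtain x where x: "x \<in> B" "card (nbrs G x \<inter> B) \<le> 1"
    using S by (auto simp: forest_on_def)
  then obtain i where i: "i < l" "x = snd (p ! i)"
    by (auto simp: B_def l_def in_set_conv_nth)
  \<comment> \<open>Arc \<open>i\<close> enters \<open>x\<close>, so the cyclically next arc
    \<open>s\<close> leads to the successor of \<open>x\<close>, and the cyclically preceding arc
    \<open>r\<close> ends in its predecessor. Length at least 3 makes \<open>s\<close> and
    \<open>r\<close> differ.\<close>
  define s where "s = (if Suc i < l then Suc i else 0)"
  define r where "r = (if i = 0 then l - 1 else i - 1)"
  have sr: "s < l" "r < l" "s \<noteq> r"
    using i(1) p(2) by (auto simp: s_def r_def l_def)
  have p_ne: "p \<noteq> []" using p(2) by auto
  have fs: "fst (p ! s) = x"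
  proof (cases "Suc i < l")
    case True
    then show ?thesis using pcas_consecutive[OF u(2), of i] i(2) by (simp add: s_def l_def)
  next
    case False
    then have "i = length p - 1" using i(1) by (simp add: l_def)
    then show ?thesis using pcas_ends[OF u(2) p_ne] i(2) False by (simp add: s_def)
  qed
  have fr: "fst (p ! i) = snd (p ! r)"
  proof (cases i)
    case 0
    then show ?thesis using pcas_ends[OF u(2) p_ne] by (simp add: r_def l_def)
  next
    case (Suc i')
    then show ?thesis using pcas_consecutive[OF u(2), of i'] i(1) by (simp add: r_def l_def)
  qed
  have "(x, snd (p ! s)) \<in> parcs G" using arc(1)[OF sr(1)] fs by (metis prod.collapse)
  moreover have "(snd (p ! r), x) \<in> parcs G"
    using arc(1)[OF i(1)] unfolding fr[symmetric] i(2) by simp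
  ultimately have "snd (p ! s) \<in> nbrs G x" "snd (p ! r) \<in> nbrs G x"
    using sym by (auto simp: nbrs_def)
  moreover have "snd (p ! s) \<in> B" "snd (p ! r) \<in> B"
    using sr by (auto simp: B_def l_def)
  moreover have "snd (p ! s) \<noteq> snd (p ! r)"
    using dist sr by (auto simp: l_def distinct_conv_nth)
  ultimately have "card {snd (p ! s), snd (p ! r)} = 2"
    "{snd (p ! s), snd (p ! r)} \<subseteq> nbrs G x \<inter> B" by auto
  moreover have "finite B" by (simp add: B_def)
  ultimately have "2 \<le> card (nbrs G x \<inter> B)"
    by (metis card_mono finite_Int)
  with x(2) show False by simp
qed

section \<open>Extending a colouring by one block\<close>

definition good_colouring ::
  "('a \<Rightarrow> 'a set) \<Rightarrow> ('a \<Rightarrow> 'c set) \<Rightarrow> 'a set \<Rightarrow> ('a \<Rightarrow> 'c) \<Rightarrow> bool" where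
  "good_colouring N L X c \<longleftrightarrow>
     (\<forall>x\<in>X. c x \<in> L x) \<and> (\<forall>y. forest_on N {x \<in> X. c x = y})"

text \<open>Each colour seen twice on \<open>X \<inter> M\<close> uses up two vertices, so at most
  \<open>card (X \<inter> M) div 2\<close> colours are lost in this way, besides those in
  \<open>F\<close>.\<close>

lemma exists_colour:
  assumes "finite X" "finite F" "card F + card (X \<inter> M) div 2 < card A"
  shows "\<exists>y\<in>A. y \<notin> F \<and> card {u \<in> X \<inter> M. c u = y} \<le> 1"
proof -
  define D where "D = {y. 2 \<le> card {u \<in> X \<inter> M. c u = y}}"
  have sub: "D \<subseteq> c ` (X \<inter> M)"
  proof
    fix y assume "y \<in> D"
    then have "card {u \<in> X \<inter> M. c u = y} \<noteq> 0" by (simp add: D_def)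
    then have "{u \<in> X \<inter> M. c u = y} \<noteq> {}" by (metis card.empty)
    then show "y \<in> c ` (X \<inter> M)" by auto
  qed
  then have finD: "finite D" using assms(1) by (auto intro: finite_subset)
  have "2 * card D = (\<Sum>y\<in>D. 2)" by simp
  also have "\<dots> \<le> (\<Sum>y\<in>D. card {u \<in> X \<inter> M. c u = y})"
    by (rule sum_mono) (simp add: D_def)
  also have "\<dots> = card (\<Union>y\<in>D. {u \<in> X \<inter> M. c u = y})"
    by (rule card_UN_disjoint[symmetric]) (use assms(1) finD in auto)
  also have "\<dots> \<le> card (X \<inter> M)"
    by (rule card_mono) (use assms(1) in auto)
  finally have "card D \<le> card (X \<inter> M) div 2" by linarith
  then have lt: "card (F \<union> D) < card A"
    using assms(3) card_Un_le[of F D] by linarith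
  have "\<not> A \<subseteq> F \<union> D"
  proof
    assume "A \<subseteq> F \<union> D"
    then have "card A \<le> card (F \<union> D)" by (rule card_mono[rotated]) (use assms(2) finD in auto)
    with lt show False by simp
  qed
  then show ?thesis by (auto simp: D_def not_le)
qed

text \<open>Greedy choice: \<open>F\<close> in \<open>exists_colour\<close> consists of the at most
  \<open>i\<close> colours already used in the block, and \<open>i + d div 2 < k\<close> amounts to
  \<open>d < 2 * (k - i)\<close>. Only neighbours in \<open>X\<close> count, because those in the
  block get other colours anyway.\<close>

lemma exists_block_colours:
  assumes "finite X" "distinct xs" "set xs \<inter> X = {}" "\<And>x. x \<in> set xs \<Longrightarrow> card (L x) = k"
    and "\<And>i. i < length xs \<Longrightarrow> card (X \<inter> N (xs ! i)) < 2 * (k - i)"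
  shows "\<exists>c'. (\<forall>x\<in>X. c' x = c x) \<and> inj_on c' (set xs) \<and>
           (\<forall>x\<in>set xs. c' x \<in> L x \<and> card {u \<in> X \<inter> N x. c' u = c' x} \<le> 1)"
  using assms
proof (induction xs rule: rev_induct)
  case Nil
  show ?case by (rule exI[of _ c]) simp
next
  case (snoc x xs)
  have "card (X \<inter> N (xs ! i)) < 2 * (k - i)" if "i < length xs" for i
    using snoc.prems(5)[of i] that by (simp add: nth_append)
  then obtain c' where c': "\<forall>x\<in>X. c' x = c x" "inj_on c' (set xs)"
    "\<forall>x\<in>set xs. c' x \<in> L x \<and> card {u \<in> X \<inter> N x. c' u = c' x} \<le> 1"
    using snoc by auto
  have "card (c' ` set xs) \<le> length xs"
    by (metis card_image_le card_length finite_set le_trans)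
  then have "card (c' ` set xs) + card (X \<inter> N x) div 2 < card (L x)"
    using snoc.prems(5)[of "length xs"] snoc.prems(4)[of x] by simp
  from exists_colour[OF snoc.prems(1) _ this, of c'] obtain y where
    y: "y \<in> L x" "y \<notin> c' ` set xs" "card {u \<in> X \<inter> N x. c' u = y} \<le> 1"
    by auto
  have eq: "{u \<in> X \<inter> N z. (c'(x := y)) u = a} = {u \<in> X \<inter> N z. c' u = a}" for z a
    using snoc.prems(3) by auto
  have ne: "x \<notin> set xs" using snoc.prems(2) by simp
  show ?case
  proof (intro exI[of _ "c'(x := y)"] conjI)
    show "\<forall>z\<in>X. (c'(x := y)) z = c z" using c'(1) snoc.prems(3) by auto
    show "inj_on (c'(x := y)) (set (xs @ [x]))"
      using c'(2) y(2) ne by (auto simp: inj_on_def)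
    show "\<forall>z\<in>set (xs @ [x]). (c'(x := y)) z \<in> L z \<and>
            card {u \<in> X \<inter> N z. (c'(x := y)) u = (c'(x := y)) z} \<le> 1"
      unfolding eq using c'(3) y ne by (simp add: Ball_def)
  qed
qed

text \<open>A block vertex has at most one neighbour of its own colour in \<open>X\<close> and none
  in the block, so it is the required low-degree vertex of every monochromatic set containing it.
  Sets that avoid the block are settled by the old colouring.\<close>

lemma extend_good_colouring:
  assumes "good_colouring N L X c" and loop: "\<And>v. v \<notin> N v"
    and "finite X" "distinct xs" "set xs \<inter> X = {}" "\<And>x. x \<in> set xs \<Longrightarrow> card (L x) = k"
    and "\<And>i. i < length xs \<Longrightarrow> card (X \<inter> N (xs ! i)) < 2 * (k - i)"
  shows "\<exists>c'. good_colouring N L (X \<union> set xs) c' \<and> (\<forall>x\<in>X. c' x = c x) \<and>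
           (\<forall>y. card {x \<in> X \<union> set xs. c' x = y} \<le> card {x \<in> X. c x = y} + 1)"
proof -
  obtain c' where c': "\<forall>x\<in>X. c' x = c x" "inj_on c' (set xs)"
    "\<forall>x\<in>set xs. c' x \<in> L x \<and> card {u \<in> X \<inter> N x. c' u = c' x} \<le> 1"
    using exists_block_colours[where c = c and L = L and N = N, OF assms(3-)] by blast
  have old: "{x \<in> X. c' x = y} = {x \<in> X. c x = y}" for y
    using c'(1) by auto
  have "forest_on N {x \<in> X \<union> set xs. c' x = y}" for y
    unfolding forest_on_def
  proof (intro allI impI)
    fix B assume B: "B \<subseteq> {x \<in> X \<union> set xs. c' x = y}" "B \<noteq> {}"
    show "\<exists>x\<in>B. card (N x \<inter> B) \<le> 1"
    proof (cases "B \<inter> set xs = {}")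
      case True
      then have "B \<subseteq> {x \<in> X. c x = y}" using B(1) c'(1) by auto
      then show ?thesis
        using assms(1) B(2) by (auto simp: good_colouring_def forest_on_def)
    next
      case False
      then obtain x where x: "x \<in> B" "x \<in> set xs" by auto
      have "N x \<inter> B \<subseteq> {u \<in> X \<inter> N x. c' u = c' x}"
      proof
        fix u assume u: "u \<in> N x \<inter> B"
        then have "c' u = c' x" "u \<noteq> x" using B(1) x loop by auto
        moreover have "u \<notin> set xs"
          using calculation x(2) c'(2) by (auto dest: inj_onD)
        ultimately show "u \<in> {u \<in> X \<inter> N x. c' u = c' x}" using u B(1) by auto
      qed
      then have "card (N x \<inter> B) \<le> card {u \<in> X \<inter> N x. c' u = c' x}"
        by (rule card_mono[rotated]) (use assms(3) in auto)
      then show ?thesis using c'(3) x by (meson le_trans)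
    qed
  qed
  then have good: "good_colouring N L (X \<union> set xs) c'"
    using assms(1) c'(1,3) by (auto simp: good_colouring_def)
  have size: "card {x \<in> X \<union> set xs. c' x = y} \<le> card {x \<in> X. c x = y} + 1" for y
  proof -
    have "{x \<in> X \<union> set xs. c' x = y} = {x \<in> X. c x = y} \<union> {x \<in> set xs. c' x = y}"
      using old by auto
    moreover have "card {x \<in> set xs. c' x = y} \<le> 1"
      using c'(2) by (auto simp: card_le_Suc0_iff_eq inj_on_def)
    ultimately show ?thesis
      using card_Un_le[of "{x \<in> X. c x = y}" "{x \<in> set xs. c' x = y}"] by simp
  qed
  show ?thesis
    using good size c'(1) by blast
qed

section \<open>Trivial forests and the grid in coordinates\<close>

lemma forest_on_empty [simp]: "forest_on N {}"
  by (simp add: forest_on_def)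

lemma forest_on_singleton: "v \<notin> N v \<Longrightarrow> forest_on N {v}"
  by (auto simp: forest_on_def subset_singleton_iff)

lemma forest_on_mono: "forest_on N A \<Longrightarrow> B \<subseteq> A \<Longrightarrow> forest_on N B"
  by (meson forest_on_def order_trans)

text \<open>A vertex \<open>((a, i), j)\<close> is thought of as lying in layer \<open>a\<close>,
  row \<open>i\<close> and column \<open>j\<close>.\<close>

abbreviation grid :: "nat \<Rightarrow> nat \<Rightarrow> ((nat \<times> nat) \<times> nat) pair_pre_digraph" where
  "grid n m \<equiv> path_graph 2 \<square> path_graph n \<square> path_graph m"

lemma pverts_grid: "pverts (grid n m) = ({0..<2} \<times> {0..<n}) \<times> {0..<m}"
  by (simp add: cart_prod_def path_graph_def)

lemma mem_nbrs_grid: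
  "((b, i'), j') \<in> nbrs (grid n m) ((a, i), j) \<longleftrightarrow>
     a < 2 \<and> b < 2 \<and> i < n \<and> i' < n \<and> j < m \<and> j' < m \<and>
     (i = i' \<and> a = b \<and> (j' = Suc j \<or> j = Suc j') \<or>
      j = j' \<and> (a = b \<and> (i' = Suc i \<or> i = Suc i') \<or> i = i' \<and> (a = Suc b \<or> b = Suc a)))"
  by (auto simp: nbrs_def cart_prod_def path_graph_def)

lemma not_mem_nbrs_grid: "v \<notin> nbrs (grid n m) v"
  by (cases v) (auto simp: mem_nbrs_grid)

lemma parcs_grid_sym: "(u, v) \<in> parcs (grid n m) \<Longrightarrow> (v, u) \<in> parcs (grid n m)"
  by (auto simp: cart_prod_def path_graph_def)

lemma card_le_1I: "A \<subseteq> {x} \<Longrightarrow> card A \<le> 1"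
  using card_mono[of "{x}" A] by simp

lemma card_le_3I: "A \<subseteq> {x, y, z} \<Longrightarrow> card A \<le> 3"
proof -
  assume "A \<subseteq> {x, y, z}"
  then have "card A \<le> card {x, y, z}" by (rule card_mono[rotated]) simp
  also have "\<dots> \<le> 3" by (simp add: card_insert_if)
  finally show ?thesis .
qed

subsection \<open>At least three colours\<close>

text \<open>The layer varies fastest, then the column, then the row, so steps in these directions
  change the number by 1, 2 and \<open>2 * m\<close>.\<close>

definition lex_index :: "nat \<Rightarrow> (nat \<times> nat) \<times> nat \<Rightarrow> nat" where
  "lex_index m = (\<lambda>((a, i), j). 2 * (i * m + j) + a)"

definition lex_vertex :: "nat \<Rightarrow> nat \<Rightarrow> (nat \<times> nat) \<times> nat" where
  "lex_vertex m t = ((t mod 2, t div 2 div m), t div 2 mod m)"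

lemma lex_index_vertex [simp]: "lex_index m (lex_vertex m t) = t"
  by (simp only: lex_index_def lex_vertex_def prod.case div_mult_mod_eq mult_div_mod_eq)

lemma lex_vertex_eq_iff [simp]: "lex_vertex m s = lex_vertex m t \<longleftrightarrow> s = t"
  by (metis lex_index_vertex)

lemma lex_vertex_image:
  assumes "m > 0"
  shows "lex_vertex m ` {0..<2 * (n * m)} = pverts (grid n m)"
proof (intro equalityI subsetI)
  fix v assume "v \<in> lex_vertex m ` {0..<2 * (n * m)}"
  then obtain t where t: "t < 2 * (n * m)" "v = lex_vertex m t" by auto
  then have "t div 2 < n * m" by linarith
  then show "v \<in> pverts (grid n m)"
    using t(2) assms by (auto simp: lex_vertex_def pverts_grid less_mult_imp_div_less)
next
  fix v assume "v \<in> pverts (grid n m)"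
  then obtain a i j where v: "v = ((a, i), j)" "a < 2" "i < n" "j < m"
    by (auto simp: pverts_grid)
  have "i * m + j < Suc i * m" using v by simp
  also have "\<dots> \<le> n * m" using v by (intro mult_le_mono1) simp
  finally have "i * m + j < n * m" .
  moreover have "2 * e + a < 2 * f" if "e < f" for e f using v(2) that by linarith
  ultimately have "2 * (i * m + j) + a < 2 * (n * m)" by blast
  moreover have "lex_vertex m (2 * (i * m + j) + a) = v"
  proof -
    have "(2 * e + a) mod 2 = a" "(2 * e + a) div 2 = e" for e
      using v(2) by presburger+
    then show ?thesis using v by (simp only: lex_vertex_def) simp
  qed
  ultimately show "v \<in> lex_vertex m ` {0..<2 * (n * m)}"
    by (metis atLeastLessThan_iff imageI zero_le)
qed

lemma nbrs_grid_lex: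
  assumes "lex_vertex m u \<in> nbrs (grid n m) (lex_vertex m s)" "s < u"
  shows "u \<in> {s + 1, s + 2, s + 2 * m}"
proof -
  obtain a i j b i' j' where eq: "lex_vertex m s = ((a, i), j)" "lex_vertex m u = ((b, i'), j')"
    by (metis prod.exhaust)
  have "s = 2 * (i * m + j) + a" "u = 2 * (i' * m + j') + b"
    using lex_index_vertex[of m s] lex_index_vertex[of m u]
    unfolding eq by (simp_all add: lex_index_def)
  then show ?thesis using assms unfolding eq mem_nbrs_grid by (auto simp: algebra_simps)
qed

text \<open>Blocks of \<open>k\<close> consecutive numbers are coloured from the highest numbers
  downwards, and each adds at most one vertex to a class. The bound is
  \<open>(2 * (n * m) - t) / k\<close> rounded up.\<close>

lemma block_colouring:
  assumes k: "k \<ge> 3" and m: "m > 0" and L: "\<forall>v\<in>pverts (grid n m). card (L v) = k"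
    and t: "t \<le> 2 * (n * m)"
  shows "\<exists>c. good_colouring (nbrs (grid n m)) L (lex_vertex m ` {t..<2 * (n * m)}) c \<and>
    (\<forall>y. card {x \<in> lex_vertex m ` {t..<2 * (n * m)}. c x = y} \<le> (2 * (n * m) - t + k - 1) div k)"
  using t
proof (induction "2 * (n * m) - t" arbitrary: t rule: less_induct)
  case less
  define T where "T = 2 * (n * m)"
  \<comment> \<open>A block shorter than \<open>k\<close> can only be the topmost one, when nothing
    is coloured yet.\<close>
  define q where "q = min k (T - t)"
  define X where "X = lex_vertex m ` {t + q..<T}"
  show ?case
  proof (cases "t = T")
    case True
    then show ?thesis by (simp add: T_def good_colouring_def)
  next
    case False
    then have tT: "t < T" using less.prems by (simp add: T_def)
    then have q: "0 < q" "t + q \<le> T" "q \<le> k" using k by (auto simp: q_def)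
    have "2 * (n * m) - (t + q) < 2 * (n * m) - t" "t + q \<le> 2 * (n * m)"
      using q tT by (simp_all add: T_def)
    from less.hyps[OF this] obtain c where
      c: "good_colouring (nbrs (grid n m)) L X c"
        "\<And>y. card {x \<in> X. c x = y} \<le> (T - (t + q) + k - 1) div k"
      unfolding T_def X_def by blast
    \<comment> \<open>Reversed, so that the smallest number takes the last and most restricted
      position.\<close>
    define xs where "xs = rev (map (lex_vertex m) [t..<t + q])"
    have set_xs: "set xs = lex_vertex m ` {t..<t + q}" by (simp add: xs_def)
    have Xxs: "X \<union> set xs = lex_vertex m ` {t..<T}"
      unfolding X_def set_xs image_Un[symmetric] using q by (intro arg_cong[where f = "image _"]) auto
    have nth: "xs ! i = lex_vertex m (t + q - Suc i)" if "i < q" for i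
      using that by (simp add: xs_def rev_nth)
    have size: "card (X \<inter> nbrs (grid n m) (xs ! i)) < 2 * (k - i)" if "i < length xs" for i
    proof -
      define s where "s = t + q - Suc i"
      have i: "i < q" using that by (simp add: xs_def)
      then have s: "s < t + q" "xs ! i = lex_vertex m s" by (auto simp: s_def nth)
      have later: "u \<in> {s + 1, s + 2, s + 2 * m} \<and> t + q \<le> u"
        if "lex_vertex m u \<in> X \<inter> nbrs (grid n m) (xs ! i)" for u
        using that nbrs_grid_lex[of m u n s] s by (auto simp: X_def)
      have sub: "X \<inter> nbrs (grid n m) (xs ! i)
          \<subseteq> lex_vertex m ` ({s + 1, s + 2, s + 2 * m} \<inter> {t + q..})"
      proof
        fix v assume v: "v \<in> X \<inter> nbrs (grid n m) (xs ! i)"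
        then obtain u where u: "v = lex_vertex m u" by (auto simp: X_def)
        then show "v \<in> lex_vertex m ` ({s + 1, s + 2, s + 2 * m} \<inter> {t + q..})"
          using later[of u] v unfolding u by blast
      qed
      show ?thesis
      proof (cases "X = {}")
        case True
        then show ?thesis using i q by simp
      next
        case False
        then have qk: "q = k" by (auto simp: X_def q_def min_def split: if_splits)
        show ?thesis
        proof (cases "i = k - 1")
          case True
          then have "s = t" using qk q by (simp add: s_def)
          \<comment> \<open>The last position tolerates one coloured neighbour;
            \<open>k \<ge> 3\<close> puts \<open>s + 1\<close> and \<open>s + 2\<close> into the
            block itself.\<close>
          then have "{s + 1, s + 2, s + 2 * m} \<inter> {t + q..} \<subseteq> {s + 2 * m}"
            using k qk by auto
          from order_trans[OF sub image_mono[OF this]]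
          have "X \<inter> nbrs (grid n m) (xs ! i) \<subseteq> {lex_vertex m (s + 2 * m)}" by simp
          then have "card (X \<inter> nbrs (grid n m) (xs ! i)) \<le> 1" by (rule card_le_1I)
          then show ?thesis using i qk by simp
        next
          case False
          \<comment> \<open>Here \<open>k - i \<ge> 2\<close>, so three coloured neighbours are
            tolerated.\<close>
          from order_trans[OF sub image_mono[OF Int_lower1]]
          have "X \<inter> nbrs (grid n m) (xs ! i)
              \<subseteq> {lex_vertex m (s + 1), lex_vertex m (s + 2), lex_vertex m (s + 2 * m)}" by simp
          then have "card (X \<inter> nbrs (grid n m) (xs ! i)) \<le> 3" by (rule card_le_3I)
          then show ?thesis using False i qk by simp
        qed
      qed
    qed
    have mem: "card (L x) = k" if "x \<in> set xs" for x
    proof -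
      have "x \<in> lex_vertex m ` {0..<2 * (n * m)}" using that q by (auto simp: set_xs T_def)
      then show ?thesis using L lex_vertex_image[OF m] by auto
    qed
    have "finite X" "distinct xs" "set xs \<inter> X = {}"
      by (auto simp: X_def xs_def distinct_map inj_on_def)
    from extend_good_colouring[OF c(1) not_mem_nbrs_grid this mem size]
    obtain c' where c': "good_colouring (nbrs (grid n m)) L (X \<union> set xs) c'"
      "\<And>y. card {x \<in> X \<union> set xs. c' x = y} \<le> card {x \<in> X. c x = y} + 1" by blast
    have "(T - (t + q) + k - 1) div k + 1 = (T - (t + q) + k - 1 + k) div k"
      using k by (subst div_add_self2) auto
    also have "\<dots> \<le> (T - t + k - 1) div k" if "q = k"
      using that q k by (intro div_le_mono) auto
    finally have step: "(T - (t + q) + k - 1) div k + 1 \<le> (T - t + k - 1) div k" if "q = k"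
      using that by simp
    have "card {x \<in> X \<union> set xs. c' x = y} \<le> (T - t + k - 1) div k" for y
    proof (cases "q = k")
      case True
      then show ?thesis using step c(2)[of y] c'(2)[of y] by linarith
    next
      case False
      then have "X = {}" using q by (auto simp: X_def q_def min_def split: if_splits)
      then have "card {x \<in> X \<union> set xs. c' x = y} \<le> 1" using c'(2)[of y] by simp
      also have "1 = k div k" using k by simp
      also have "\<dots> \<le> (T - t + k - 1) div k" using tT by (intro div_le_mono) auto
      finally show ?thesis .
    qed
    then show ?thesis using c'(1) by (auto simp: T_def[symmetric] Xxs)
  qed
qed

subsection \<open>Two colours\<close>

text \<open>
  The numeric condition says that all coloured vertices but one, which has colour \<open>x\<^sub>0\<close>, are
  paired into differently coloured pairs.
\<close>

definition pairable ::
  "('a \<Rightarrow> 'a set) \<Rightarrow> ('a \<Rightarrow> 'c set) \<Rightarrow> 'c \<Rightarrow> 'a set \<Rightarrow> bool" where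
  "pairable N L x\<^sub>0 X \<longleftrightarrow> finite X \<and> (\<exists>c. good_colouring N L X c \<and>
     (\<forall>y. 2 * card {x \<in> X. c x = y} + 1 \<le> card X + (if y = x\<^sub>0 then 2 else 0)))"

lemma pairable_singleton: "v \<notin> N v \<Longrightarrow> x\<^sub>0 \<in> L v \<Longrightarrow> pairable N L x\<^sub>0 {v}"
  unfolding pairable_def good_colouring_def
  by (intro conjI exI[of _ "\<lambda>_. x\<^sub>0"]) (auto intro: forest_on_mono[OF forest_on_singleton])

text \<open>The block is \<open>[v, u]\<close>: \<open>v\<close> comes first and tolerates 3
  coloured neighbours, \<open>u\<close> comes second and tolerates 1. Both sides of the numeric
  condition grow by at most, respectively exactly, 2.\<close>

lemma pairable_insert2:
  assumes "pairable N L x\<^sub>0 X" and loop: "\<And>v. v \<notin> N v"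
    and "u \<noteq> v" "u \<notin> X" "v \<notin> X" "card (L u) = 2" "card (L v) = 2"
    and "card (X \<inter> N u) \<le> 1" "card (X \<inter> N v) \<le> 3"
  shows "pairable N L x\<^sub>0 (insert u (insert v X))"
proof -
  obtain c where c: "finite X" "good_colouring N L X c"
    "\<And>y. 2 * card {x \<in> X. c x = y} + 1 \<le> card X + (if y = x\<^sub>0 then 2 else 0)"
    using assms(1) by (auto simp: pairable_def)
  have size: "card (X \<inter> N ([v, u] ! i)) < 2 * (2 - i)" if "i < length [v, u]" for i
    using that assms by (cases i) auto
  have L: "card (L x) = 2" if "x \<in> set [v, u]" for x using that assms by auto
  have "distinct [v, u]" "set [v, u] \<inter> X = {}" using assms by auto
  from extend_good_colouring[OF c(2) loop c(1) this L size]
  obtain c' where c': "good_colouring N L (X \<union> set [v, u]) c'"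
    "\<And>y. card {x \<in> X \<union> set [v, u]. c' x = y} \<le> card {x \<in> X. c x = y} + 1" by blast
  have eq: "X \<union> set [v, u] = insert u (insert v X)" by auto
  have "card (insert u (insert v X)) = card X + 2" using assms c(1) by simp
  then have "2 * card {x \<in> insert u (insert v X). c' x = y} + 1
      \<le> card (insert u (insert v X)) + (if y = x\<^sub>0 then 2 else 0)" for y
    using c'(2)[of y] c(3)[of y] unfolding eq by linarith
  moreover have "finite (insert u (insert v X))" using c(1) by simp
  ultimately show ?thesis using c'(1) unfolding pairable_def eq by blast
qed

section \<open>From one row to the whole grid\<close>

definition rows :: "nat \<Rightarrow> nat set \<Rightarrow> ((nat \<times> nat) \<times> nat) set" where
  "rows m R = ({0..<2} \<times> R) \<times> {0..<m}"

text \<open>The rows in \<open>R\<close> are coloured except for \<open>s\<close>, which waits for its partner in the next row.\<close>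

definition ready ::
  "nat \<Rightarrow> nat \<Rightarrow> ((nat \<times> nat) \<times> nat \<Rightarrow> 'c set) \<Rightarrow> 'c \<Rightarrow> nat set \<Rightarrow> (nat \<times> nat) \<times> nat \<Rightarrow> bool"
  where
  "ready n m L x\<^sub>0 R s \<longleftrightarrow> s \<in> rows m R \<and> pairable (nbrs (grid n m)) L x\<^sub>0 (rows m R - {s}) \<and>
     card ((rows m R - {s}) \<inter> nbrs (grid n m) s) \<le> 3"

context
  fixes n m :: nat and L :: "(nat \<times> nat) \<times> nat \<Rightarrow> 'c set" and x\<^sub>0 :: 'c
  assumes L: "\<And>v. v \<in> pverts (grid n m) \<Longrightarrow> card (L v) = 2"
begin

text \<open>The given vertex takes \<open>x\<^sub>0\<close> and the other vertex of its column
  waits. The columns to the right, then those to the left, are added as pairs; each new vertex has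
  only its neighbour in the adjacent column already coloured.\<close>

lemma ready_single_row:
  assumes "l < 2" "i < n" "j < m" "x\<^sub>0 \<in> L ((l, i), j)"
  shows "ready n m L x\<^sub>0 {i} ((1 - l, i), j)"
proof -
  let ?N = "nbrs (grid n m)"
  \<comment> \<open>Columns \<open>lo\<close> to \<open>hi - 1\<close> of the row, without the
    waiting vertex.\<close>
  define C where
    "C lo hi = {((a, i), h) | a h. a < 2 \<and> lo \<le> h \<and> h < hi \<and> (h = j \<longrightarrow> a = l)}" for lo hi
  have mem_C: "((a, i'), h) \<in> C lo hi \<longleftrightarrow>
      i' = i \<and> a < 2 \<and> lo \<le> h \<and> h < hi \<and> (h = j \<longrightarrow> a = l)" for a i' h lo hi
    by (auto simp: C_def)
  have grow: "pairable ?N L x\<^sub>0 (C lo' hi')"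
    if "pairable ?N L x\<^sub>0 (C lo hi)" "C lo' hi' = insert ((0, i), h) (insert ((1, i), h) (C lo hi))"
      "\<And>a. C lo hi \<inter> ?N ((a, i), h) \<subseteq> {((a, i), h')}" "h < m" "h < lo \<or> hi \<le> h"
    for lo hi lo' hi' h h'
    unfolding that(2)
  proof (rule pairable_insert2[OF that(1) not_mem_nbrs_grid])
    have one: "card (C lo hi \<inter> ?N ((a, i), h)) \<le> 1" for a
      using that(3) by (rule card_le_1I)
    show "card (C lo hi \<inter> ?N ((0, i), h)) \<le> 1" by (rule one)
    show "card (C lo hi \<inter> ?N ((1, i), h)) \<le> 3" by (rule le_trans[OF one]) simp
    show "card (L ((0, i), h)) = 2" "card (L ((1, i), h)) = 2"
      using that(4) assms(2) by (auto intro!: L simp: pverts_grid)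
  qed (use that(5) in \<open>auto simp: mem_C\<close>)
  have right: "pairable ?N L x\<^sub>0 (C j hi)" if "Suc j \<le> hi" "hi \<le> m" for hi
    using that
  proof (induction hi rule: dec_induct)
    case base
    have "C j (Suc j) = {((l, i), j)}" using assms by (auto simp: C_def)
    then show ?case using assms by (simp add: pairable_singleton not_mem_nbrs_grid)
  next
    case (step h)
    have "((a, i'), h') \<in> C j (Suc h) \<longleftrightarrow>
        ((a, i'), h') \<in> insert ((0, i), h) (insert ((1, i), h) (C j h))" for a i' h'
      using step.hyps(1) by (cases "h' = h") (auto simp: mem_C)
    then have "C j (Suc h) = insert ((0, i), h) (insert ((1, i), h) (C j h))" by auto
    moreover have "C j h \<inter> ?N ((a, i), h) \<subseteq> {((a, i), h - 1)}" for a
      by (auto simp: mem_C mem_nbrs_grid)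
    moreover have "pairable ?N L x\<^sub>0 (C j h)" using step by simp
    ultimately show ?case
      using step.prems by (intro grow[of j h j "Suc h" h "h - 1"]) simp_all
  qed
  have left: "pairable ?N L x\<^sub>0 (C lo m)" if "lo \<le> j" for lo
    using that
  proof (induction lo rule: inc_induct)
    case base
    show ?case using right[of m] assms by simp
  next
    case (step h)
    have hm: "h < m" using step.hyps assms(3) by simp
    then have "((a, i'), h') \<in> C h m \<longleftrightarrow>
        ((a, i'), h') \<in> insert ((0, i), h) (insert ((1, i), h) (C (Suc h) m))" for a i' h'
      using step.hyps(2) by (cases "h' = h") (auto simp: mem_C)
    then have "C h m = insert ((0, i), h) (insert ((1, i), h) (C (Suc h) m))" by auto
    moreover have "C (Suc h) m \<inter> ?N ((a, i), h) \<subseteq> {((a, i), Suc h)}" for a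
      by (auto simp: mem_C mem_nbrs_grid)
    moreover have "pairable ?N L x\<^sub>0 (C (Suc h) m)" using step by simp
    ultimately show ?case
      using hm by (intro grow[of "Suc h" m h m h "Suc h"]) simp_all
  qed
  have "rows m {i} - {((1 - l, i), j)} = C 0 m"
    using assms by (auto simp: mem_C rows_def less_2_cases_iff)
  moreover have "card (C 0 m \<inter> ?N ((1 - l, i), j)) \<le> 3"
    by (rule card_le_3I[of _ "((l, i), j)" "((1 - l, i), Suc j)" "((1 - l, i), j - 1)"])
      (auto simp: mem_C mem_nbrs_grid)
  moreover have "((1 - l, i), j) \<in> rows m {i}" using assms by (auto simp: rows_def)
  ultimately show ?thesis
    using left[of 0] by (simp add: ready_def)
qed

text \<open>
  A new row is coloured from its last column to its first, alternating between the layers: first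
  its last vertex in one layer together with the vertex \<open>s\<close> left over so far, then dominoes
  inside the layers. In the proof, \<open>Z t\<close> is the part of the row coloured when column \<open>t\<close> is
  reached: all later columns and the vertex of column \<open>t\<close> in layer \<open>b t\<close>.
\<close>

lemma ready_insert_row:
  assumes rd: "ready n m L x\<^sub>0 R s" and R: "R \<subseteq> {0..<n}" and r: "r < n" "r \<notin> R"
    and adj: "\<And>i. i \<in> R \<Longrightarrow> i = Suc r \<or> r = Suc i \<Longrightarrow> i = q"
  shows "ready n m L x\<^sub>0 (insert r R) ((0, r), 0)"
proof -
  let ?N = "nbrs (grid n m)"
  \<comment> \<open>The shift by one gives \<open>b 0 = 1\<close>, so that
    \<open>((0, r), 0)\<close> is the vertex left over at the end.\<close>
  define b :: "nat \<Rightarrow> nat" where "b t = Suc t mod 2" for t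
  have b: "b t < 2" "b (Suc t) = 1 - b t" "b 0 = 1" for t
    by (simp_all add: b_def mod_Suc)
  have ne: "b t \<noteq> 1 - b t" "1 - b t \<noteq> b t" for t
    using b(1)[of t] by arith+
  have flip: "a = b t \<or> a = 1 - b t" if "a < 2" for a t
    using that b(1)[of t] by (auto simp: less_2_cases_iff)
  define Z where "Z t = {((a, r), h) | a h. a < 2 \<and> t \<le> h \<and> h < m \<and> (h = t \<longrightarrow> a = b t)}" for t
  have mem_Z: "((a, i), h) \<in> Z t \<longleftrightarrow> i = r \<and> a < 2 \<and> t \<le> h \<and> h < m \<and> (h = t \<longrightarrow> a = b t)"
    for a i h t by (auto simp: Z_def)
  \<comment> \<open>Only row \<open>q\<close> of \<open>R\<close> borders row \<open>r\<close>, so a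
    new vertex has at most one neighbour in the old rows.\<close>
  have vertical: "v = ((a, q), h)" if v: "v \<in> rows m R" "v \<in> ?N ((a, r), h)" for v a h
  proof -
    obtain a' i h' where eq: "v = ((a', i), h')" by (metis prod.exhaust)
    have "i \<in> R" using v(1) by (simp add: eq rows_def)
    then have "a' = a \<and> h' = h \<and> (i = Suc r \<or> r = Suc i)"
      using v(2) r(2) unfolding eq mem_nbrs_grid by metis
    then show ?thesis using adj[OF \<open>i \<in> R\<close>] by (simp add: eq)
  qed
  from rd have s: "s \<in> rows m R" and ps: "pairable ?N L x\<^sub>0 (rows m R - {s})"
    and cs: "card ((rows m R - {s}) \<inter> ?N s) \<le> 3"
    by (simp_all add: ready_def)
  then have m: "m > 0" by (auto simp: rows_def)
  have notin: "((a, r), h) \<notin> rows m R" for a h using r(2) by (simp add: rows_def)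
  have L2: "card (L ((a, r), h)) = 2" if "a < 2" "h < m" for a h
    using that r(1) by (intro L) (simp add: pverts_grid)
  have "pairable ?N L x\<^sub>0 (rows m R \<union> Z t)" if "t \<le> m - 1" for t
    using that
  proof (induction t rule: inc_induct)
    case base
    define x where "x = ((b (m - 1), r), m - 1)"
    have "((a, i), h) \<in> Z (m - 1) \<longleftrightarrow> ((a, i), h) = x" for a i h
      using m b(1)[of "m - 1"] by (cases "h = m - 1") (auto simp: mem_Z x_def)
    then have "Z (m - 1) = {x}" by auto
    then have eq: "rows m R \<union> Z (m - 1) = insert x (insert s (rows m R - {s}))"
      using s by blast
    have cx: "card ((rows m R - {s}) \<inter> ?N x) \<le> 1"
      by (rule card_le_1I[of _ "((b (m - 1), q), m - 1)"]) (use vertical in \<open>auto simp: x_def\<close>)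
    have Lx: "card (L x) = 2" using L2 b m by (simp add: x_def)
    have "s \<in> pverts (grid n m)" using s R by (auto simp: pverts_grid rows_def)
    then have Ls: "card (L s) = 2" by (rule L)
    have "x \<notin> rows m R" by (simp add: x_def notin)
    then show ?case
      unfolding eq
      using s by (intro pairable_insert2[OF ps not_mem_nbrs_grid _ _ _ Lx Ls cx cs]) auto
  next
    case (step t)
    \<comment> \<open>The domino completes column \<open>Suc t\<close> by \<open>y\<close> and opens
      column \<open>t\<close> by \<open>x\<close>. Of the coloured vertices, \<open>x\<close> sees
      only the one in row \<open>q\<close>; \<open>y\<close> may also see the other layer and column
      \<open>Suc (Suc t)\<close>.\<close>
    define x where "x = ((b t, r), t)"
    define y where "y = ((b t, r), Suc t)"
    have t: "Suc t < m" using step.hyps by simp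
    have "((a, i), h) \<in> Z t \<longleftrightarrow> ((a, i), h) \<in> insert x (insert y (Z (Suc t)))" for a i h
      using t b(1)[of t] flip[of a t]
      by (cases "h = t"; cases "h = Suc t") (auto simp: mem_Z x_def y_def b(2))
    then have "Z t = insert x (insert y (Z (Suc t)))" by auto
    then have eq: "rows m R \<union> Z t = insert x (insert y (rows m R \<union> Z (Suc t)))" by simp
    have Zx: "v \<notin> Z (Suc t)" if "v \<in> ?N x" for v
    proof (cases v)
      case (Pair c h)
      then show ?thesis using that ne[of t] by (cases c) (auto simp: mem_Z x_def mem_nbrs_grid b(2))
    qed
    have Zy: "v \<in> {((b t, r), Suc (Suc t)), ((1 - b t, r), Suc t)}"
      if "v \<in> ?N y" "v \<in> Z (Suc t)" for v
    proof (cases v)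
      case (Pair c h)
      then show ?thesis using that by (cases c) (auto simp: mem_Z y_def mem_nbrs_grid b(2))
    qed
    have cx: "card ((rows m R \<union> Z (Suc t)) \<inter> ?N x) \<le> 1"
      by (rule card_le_1I[of _ "((b t, q), t)"]) (use vertical Zx in \<open>auto simp: x_def\<close>)
    have "(rows m R \<union> Z (Suc t)) \<inter> ?N y
        \<subseteq> {((b t, q), Suc t), ((b t, r), Suc (Suc t)), ((1 - b t, r), Suc t)}"
      using vertical[of _ "b t" "Suc t"] Zy unfolding y_def by blast
    then have cy: "card ((rows m R \<union> Z (Suc t)) \<inter> ?N y) \<le> 3" by (rule card_le_3I)
    have Lxy: "card (L x) = 2" "card (L y) = 2"
      using L2 b(1) t by (simp_all add: x_def y_def)
    have ps: "pairable ?N L x\<^sub>0 (rows m R \<union> Z (Suc t))" using step by simp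
    have "x \<noteq> y" "x \<notin> rows m R \<union> Z (Suc t)" "y \<notin> rows m R \<union> Z (Suc t)"
      using ne[of t] by (simp_all add: notin mem_Z b(2) x_def y_def)
    then show ?case
      unfolding eq by (intro pairable_insert2[OF ps not_mem_nbrs_grid _ _ _ Lxy cx cy])
  qed
  then have "pairable ?N L x\<^sub>0 (rows m R \<union> Z 0)" by simp
  moreover have "rows m (insert r R) - {((0, r), 0)} = rows m R \<union> Z 0"
  proof -
    have "((a, i), h) \<in> rows m (insert r R) - {((0, r), 0)} \<longleftrightarrow> ((a, i), h) \<in> rows m R \<union> Z 0"
      for a i h
      using r(2) by (cases "h = 0") (auto simp: mem_Z rows_def b(3) less_2_cases_iff)
    then show ?thesis unfolding set_eq_iff split_paired_All by blast
  qed
  moreover have "(rows m R \<union> Z 0) \<inter> ?N ((0, r), 0) \<subseteq> {((0, q), 0), ((0, r), 1), ((1, r), 0)}"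
  proof -
    have "v \<in> {((0, r), 1), ((1, r), 0)}" if "v \<in> Z 0" "v \<in> ?N ((0, r), 0)" for v
    proof (cases v)
      case (Pair c h)
      then show ?thesis using that by (cases c) (auto simp: mem_Z mem_nbrs_grid b(3))
    qed
    then show ?thesis using vertical[of _ 0 0] by blast
  qed
  then have "card ((rows m R \<union> Z 0) \<inter> ?N ((0, r), 0)) \<le> 3" by (rule card_le_3I)
  moreover have "((0, r), 0) \<in> rows m (insert r R)" using m by (simp add: rows_def)
  ultimately show ?thesis by (simp add: ready_def)
qed

text \<open>Rows are added above \<open>i\<close> up to \<open>hi\<close>, then below
  \<open>i\<close> down to \<open>lo\<close>; thus each new row borders the coloured interval on one
  side only, as \<open>ready_insert_row\<close> demands.\<close>

lemma ready_interval:
  assumes "l < 2" "i < n" "j < m" "x\<^sub>0 \<in> L ((l, i), j)" "lo \<le> i" "i \<le> hi" "hi < n"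
  shows "\<exists>s. ready n m L x\<^sub>0 {lo..hi} s"
proof -
  have up: "\<exists>s. ready n m L x\<^sub>0 {i..hi} s"
    using assms(6,7)
  proof (induction hi rule: dec_induct)
    case base
    show ?case using ready_single_row[OF assms(1-4)] by auto
  next
    case (step h)
    then obtain s where "ready n m L x\<^sub>0 {i..h} s" by auto
    then have "ready n m L x\<^sub>0 (insert (Suc h) {i..h}) ((0, Suc h), 0)"
      by (rule ready_insert_row[where q = h]) (use step in auto)
    then show ?case using step by (auto simp: atLeastAtMostSuc_conv)
  qed
  show ?thesis
    using assms(5)
  proof (induction lo rule: inc_induct)
    case base
    show ?case by (rule up)
  next
    case (step h)
    then obtain s where "ready n m L x\<^sub>0 {Suc h..hi} s" by auto
    then have "ready n m L x\<^sub>0 (insert h {Suc h..hi}) ((0, h), 0)"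
      by (rule ready_insert_row[where q = "Suc h"]) (use step assms in auto)
    moreover have "insert h {Suc h..hi} = {h..hi}" using step assms by auto
    ultimately show ?case by auto
  qed
qed

text \<open>Adding the border row \<open>r\<close> last makes the corner \<open>((0, r), 0)\<close>
  the vertex left over; the other rows form an interval containing \<open>i\<close>.\<close>

lemma ready_all_rows:
  assumes "l < 2" "i < n" "j < m" "x\<^sub>0 \<in> L ((l, i), j)" "r = 0 \<or> r = n - 1" "i \<noteq> r"
  shows "ready n m L x\<^sub>0 {0..<n} ((0, r), 0)"
  using assms(5)
proof
  assume r: "r = 0"
  have "\<exists>s. ready n m L x\<^sub>0 {1..n - 1} s"
    by (rule ready_interval[OF assms(1-4)]) (use assms r in auto)
  then obtain s where "ready n m L x\<^sub>0 {1..n - 1} s" by blast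
  then have "ready n m L x\<^sub>0 (insert r {1..n - 1}) ((0, r), 0)"
    by (rule ready_insert_row[where q = 1]) (use assms r in auto)
  moreover have "insert r {1..n - 1} = {0..<n}" using r assms by auto
  ultimately show ?thesis by simp
next
  assume r: "r = n - 1"
  have "\<exists>s. ready n m L x\<^sub>0 {0..n - 2} s"
    by (rule ready_interval[OF assms(1-4)]) (use assms r in auto)
  then obtain s where "ready n m L x\<^sub>0 {0..n - 2} s" by blast
  then have "ready n m L x\<^sub>0 (insert r {0..n - 2}) ((0, r), 0)"
    by (rule ready_insert_row[where q = "n - 2"]) (use assms r in auto)
  moreover have "insert r {0..n - 2} = {0..<n}" using r assms by auto
  ultimately show ?thesis by simp
qed

lemma ready_imp_colouring:
  assumes "ready n m L x\<^sub>0 {0..<n} s" "x\<^sub>0 \<notin> L s"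
  shows "\<exists>c. good_colouring (nbrs (grid n m)) L (pverts (grid n m)) c \<and>
           (\<forall>y. card {x \<in> pverts (grid n m). c x = y} \<le> n * m)"
proof -
  let ?V = "pverts (grid n m)"
  define X where "X = ?V - {s}"
  have V: "rows m {0..<n} = ?V" by (simp add: rows_def pverts_grid)
  have s: "s \<in> ?V" using assms(1) by (simp add: ready_def V)
  obtain c where c: "finite X" "good_colouring (nbrs (grid n m)) L X c"
    "\<And>y. 2 * card {x \<in> X. c x = y} + 1 \<le> card X + (if y = x\<^sub>0 then 2 else 0)"
    and d: "card (X \<inter> nbrs (grid n m) s) \<le> 3"
    using assms(1) by (auto simp: ready_def V X_def pairable_def)
  have size: "card (X \<inter> nbrs (grid n m) ([s] ! i)) < 2 * (2 - i)" if "i < length [s]" for i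
    using d that by simp
  have L': "card (L x) = 2" if "x \<in> set [s]" for x using that s L by simp
  have "distinct [s]" "set [s] \<inter> X = {}" by (auto simp: X_def)
  from extend_good_colouring[OF c(2) not_mem_nbrs_grid c(1) this L' size]
  obtain c' where c': "good_colouring (nbrs (grid n m)) L (X \<union> set [s]) c'"
    "\<And>x. x \<in> X \<Longrightarrow> c' x = c x"
    "\<And>y. card {x \<in> X \<union> set [s]. c' x = y} \<le> card {x \<in> X. c x = y} + 1"
    by blast
  have c's: "c' s \<in> L s" using c'(1) by (simp add: good_colouring_def)
  have eq: "X \<union> set [s] = ?V" using s by (auto simp: X_def)
  have "card ?V = 2 * (n * m)" by (simp add: pverts_grid)
  then have cX: "card X + 1 = 2 * (n * m)"
    using s c(1) card_Suc_Diff1[of ?V s] by (simp add: X_def)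
  \<comment> \<open>Before \<open>s\<close> is coloured, a class has at most
    \<open>n * m - 1\<close> vertices, or \<open>n * m\<close> for colour \<open>x\<^sub>0\<close>,
    which \<open>s\<close> cannot receive.\<close>
  have "card {x \<in> ?V. c' x = y} \<le> n * m" for y
  proof (cases "y = x\<^sub>0")
    case True
    then have "c' s \<noteq> y" using c's assms(2) by auto
    then have "{x \<in> ?V. c' x = y} = {x \<in> X. c' x = y}" by (auto simp: X_def)
    also have "\<dots> = {x \<in> X. c x = y}" using c'(2) by (intro Collect_cong) auto
    finally have "{x \<in> ?V. c' x = y} = {x \<in> X. c x = y}" .
    then show ?thesis using c(3)[of y] cX True by simp
  next
    case False
    then show ?thesis using c(3)[of y] c'(3)[of y] cX unfolding eq by simp
  qed
  then show ?thesis using c'(1) unfolding eq by auto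
qed

text \<open>Adjacent vertices of equal parity differ in the column only, so every class is a union
  of disjoint paths along the columns.\<close>

lemma constant_lists_colouring:
  assumes "\<And>v. v \<in> pverts (grid n m) \<Longrightarrow> L v = A" "card A = 2"
  shows "\<exists>c. good_colouring (nbrs (grid n m)) L (pverts (grid n m)) c \<and>
           (\<forall>y. card {x \<in> pverts (grid n m). c x = y} \<le> n * m)"
proof -
  let ?V = "pverts (grid n m)"
  obtain p p' where p: "A = {p, p'}" "p \<noteq> p'" using assms(2) by (meson card_2_iff)
  define c where "c = (\<lambda>((a, i), j :: nat). if even (a + i :: nat) then p else p')"
  have "forest_on (nbrs (grid n m)) {x \<in> ?V. c x = y}" for y
    unfolding forest_on_def
  proof (intro allI impI)
    fix B assume B: "B \<subseteq> {x \<in> ?V. c x = y}" "B \<noteq> {}"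
    \<comment> \<open>A vertex of smallest column in \<open>B\<close> can only have a neighbour in
      the next column.\<close>
    obtain v where v: "v \<in> B" "\<And>u. u \<in> B \<Longrightarrow> snd v \<le> snd u"
      using ex_has_least_nat[of "\<lambda>v. v \<in> B" _ snd] B(2) by blast
    obtain a i j where aij: "v = ((a, i), j)" by (metis prod.exhaust)
    have "nbrs (grid n m) v \<inter> B \<subseteq> {((a, i), Suc j)}"
    proof
      fix u assume u: "u \<in> nbrs (grid n m) v \<inter> B"
      obtain b i' j' where u': "u = ((b, i'), j')" by (metis prod.exhaust)
      have "{u, v} \<subseteq> {x \<in> ?V. c x = y}" using u v(1) B(1) by blast
      then have "c u = c v" by simp
      moreover have "j \<le> j'" using v(2)[of u] u by (simp add: u' aij)
      ultimately show "u \<in> {((a, i), Suc j)}"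
        using u p(2) by (auto simp: u' aij mem_nbrs_grid c_def split: if_splits)
    qed
    then show "\<exists>x\<in>B. card (nbrs (grid n m) x \<inter> B) \<le> 1"
      by (intro bexI[OF _ v(1)]) (rule card_le_1I)
  qed
  moreover have "c v \<in> A" for v by (simp add: c_def p split: prod.split)
  ultimately have "good_colouring (nbrs (grid n m)) L ?V c"
    using assms(1) by (simp add: good_colouring_def)
  moreover have "card {x \<in> ?V. c x = y} \<le> n * m" for y
  proof -
    \<comment> \<open>The two layers get different colours at each row and column, so a class meets
      each such position at most once.\<close>
    have "inj_on (\<lambda>v. (snd (fst v), snd v)) {x \<in> ?V. c x = y}"
    proof (rule inj_onI)
      fix u v
      assume uv: "u \<in> {x \<in> ?V. c x = y}" "v \<in> {x \<in> ?V. c x = y}"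
        "(snd (fst u), snd u) = (snd (fst v), snd v)"
      obtain a b i j where eq: "u = ((a, i), j)" "v = ((b, i), j)"
        using uv(3) by (cases u; cases v; cases "fst u"; cases "fst v") simp
      have "c u = c v" using uv(1,2) by simp
      then have "even a \<longleftrightarrow> even b" using p(2) by (simp add: eq c_def split: if_splits)
      moreover have "a < 2" "b < 2" using uv(1,2) by (auto simp: eq pverts_grid)
      ultimately show "u = v" by (auto simp: eq less_2_cases_iff)
    qed
    then have "card {x \<in> ?V. c x = y} \<le> card ({0..<n} \<times> {0..<m})"
      by (rule card_inj_on_le) (auto simp: pverts_grid)
    then show ?thesis by simp
  qed
  ultimately show ?thesis by blast
qed

end

lemma two_colouring:
  assumes "n \<ge> 2" "m \<ge> 2" and L: "\<And>v. v \<in> pverts (grid n m) \<Longrightarrow> card (L v) = 2"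
  shows "\<exists>c. good_colouring (nbrs (grid n m)) L (pverts (grid n m)) c \<and>
           (\<forall>y. card {x \<in> pverts (grid n m). c x = y} \<le> n * m)"
proof (cases "\<exists>r l i j. (r = 0 \<or> r = n - 1) \<and> l < 2 \<and> i < n \<and> j < m \<and> i \<noteq> r \<and>
    L ((l, i), j) \<noteq> L ((0, r), 0)")
  case True
  then obtain r l i j where r: "r = 0 \<or> r = n - 1" "l < 2" "i < n" "j < m" "i \<noteq> r"
    "L ((l, i), j) \<noteq> L ((0, r), 0)" by blast
  have c2: "card (L ((l, i), j)) = 2" "card (L ((0, r), 0)) = 2"
    using r assms by (auto intro!: L simp: pverts_grid)
  \<comment> \<open>Distinct sets of equal finite size are not nested.\<close>
  then have "\<not> L ((l, i), j) \<subseteq> L ((0, r), 0)"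
    using r(6) card_subset_eq[of "L ((0, r), 0)" "L ((l, i), j)"] card.infinite by fastforce
  then obtain x\<^sub>0 where x: "x\<^sub>0 \<in> L ((l, i), j)" "x\<^sub>0 \<notin> L ((0, r), 0)" by blast
  have "ready n m L x\<^sub>0 {0..<n} ((0, r), 0)"
    by (rule ready_all_rows[OF L]) (use r x in auto)
  then show ?thesis
    by (intro ready_imp_colouring[where x\<^sub>0 = x\<^sub>0 and s = "((0, r), 0)"]) (use L x in auto)
next
  case False
  then have *: "L ((l, i), j) = L ((0, r), 0)"
    if "r = 0 \<or> r = n - 1" "l < 2" "i < n" "j < m" "i \<noteq> r" for r l i j
    using that by blast
  have "L v = L ((0, 0), 0)" if vV: "v \<in> pverts (grid n m)" for v
  proof -
    obtain l i j where v: "v = ((l, i), j)" "l < 2" "i < n" "j < m"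
      using vV by (auto simp: pverts_grid)
    show ?thesis
    proof (cases "i = 0")
      case True
      \<comment> \<open>Row 0 is compared with the corner of row \<open>n - 1\<close>, which in turn
        agrees with the corner of row 0; \<open>n \<ge> 2\<close> keeps these rows apart.\<close>
      then show ?thesis using v assms *[of "n - 1" l i j] *[of 0 0 "n - 1" 0] by simp
    next
      case False
      then show ?thesis using v *[of 0 l i j] by simp
    qed
  qed
  moreover have "card (L ((0, 0), 0)) = 2" using assms by (auto intro!: L simp: pverts_grid)
  ultimately show ?thesis
    by (intro constant_lists_colouring[where A = "L ((0, 0), 0)"]) (use L in auto)
qed

section \<open>Combining the cases\<close>

theorem theorem7:
  fixes k n\<^sub>2 n\<^sub>3 :: nat
  assumes "n\<^sub>2 \<ge> 2" and "n\<^sub>3 \<ge> 2" and "k \<ge> 2"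
  shows "equitably_list_arborable TYPE('c) k
           (path_graph 2 \<square> path_graph n\<^sub>2 \<square> path_graph n\<^sub>3)"
  unfolding equitably_list_arborable_def
proof (intro allI impI)
  let ?G = "grid n\<^sub>2 n\<^sub>3"
  let ?V = "pverts ?G"
  fix L :: "(nat \<times> nat) \<times> nat \<Rightarrow> 'c set"
  assume "uniform_list_assignment ?G k L"
  then have L: "\<And>v. v \<in> ?V \<Longrightarrow> card (L v) = k"
    by (simp add: uniform_list_assignment_def)
  have cV: "card ?V = 2 * (n\<^sub>2 * n\<^sub>3)" by (simp add: pverts_grid)
  obtain c where c: "good_colouring (nbrs ?G) L ?V c"
    "\<And>y. card {x \<in> ?V. c x = y} \<le> (card ?V + k - 1) div k"
  proof (cases "k = 2")
    case True
    then show ?thesis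
      using that two_colouring[of n\<^sub>2 n\<^sub>3 L] assms L by (auto simp: cV)
  next
    case False
    then show ?thesis
      using that block_colouring[of k n\<^sub>3 n\<^sub>2 L 0] assms L by (auto simp: cV lex_vertex_image)
  qed
  \<comment> \<open>The natural-number quotient is the rounded-up quotient of the definition; for
    \<open>k = 2\<close> it equals \<open>n\<^sub>2 * n\<^sub>3\<close>.\<close>
  have "int ((card ?V + k - 1) div k) \<le> \<lceil>real (card ?V) / real k\<rceil>"
  proof -
    have "(card ?V + k - 1) div k * k \<le> card ?V + k - 1" by (rule div_times_less_eq_dividend)
    then have "(card ?V + k - 1) div k * k < card ?V + k" using assms by linarith
    then have "real ((card ?V + k - 1) div k) * real k < real (card ?V) + real k"
      by (metis of_nat_add of_nat_less_iff of_nat_mult)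
    then have "real ((card ?V + k - 1) div k) - 1 < real (card ?V) / real k"
      using assms by (simp add: field_simps)
    then show ?thesis by (simp add: le_ceiling_iff)
  qed
  then have "equitable_colouring ?G k c"
    unfolding equitable_colouring_def colour_class_def
    by (intro allI order_trans[OF of_nat_mono[OF c(2)]])
  moreover have "list_colouring ?G L c"
    using c(1) by (simp add: list_colouring_def good_colouring_def)
  moreover have "acyclic_graph (with_proj ?G \<restriction> colour_class ?G c x)" for x
  proof (rule acyclic_graph_induce_subgraph)
    show "forest_on (nbrs ?G) (colour_class ?G c x)"
      using c(1) by (simp add: good_colouring_def colour_class_def)
  qed (rule parcs_grid_sym)
  ultimately show "\<exists>c. list_colouring ?G L c \<and> equitable_colouring ?G k c \<and>
      (\<forall>x. acyclic_graph (with_proj ?G \<restriction> colour_class ?G c x))"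
    by blast
qed

end
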